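(* For all integers $k\geq 2$ and $L\geq 200k$, \[ \mathbb{E}\bigl[P_1(L)-P_0(L)\bigr]\geq \sqrt{\frac{L}{7k}} . \]
   Context: Let $[k]=\{1,\dots,k\}$. A subsequence of a word is obtained by deleting some (not necessarily contiguous) symbols. For words $u,u'$ and an integer $d\ge 0$, write $u\prec_d u'$ if one can remove at most $d$ symbols from $u$ and obtain a subsequence of $u'$. For a word $u$, $u_{<m}$ denotes its prefix of length $m$. Let $w$ and $w'$ be two independent infinite random words whose symbols are independent and uniform on $[k]$. For integers $d,L\ge 0$ put \[ P_d(L)=\max\{m : w_{<m}\prec_d w'_{<L}\} \] (the same $w,w'$ are used for all $d$). *)

theory Defs
  imports "HOL-Probability.Probability" "HOL-Library.Sublist"
begin

definition subseq_upto :: "nat \<Rightarrow> 'a list \<Rightarrow> 'a list \<Rightarrow> bool" where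
  "subseq_upto d u u' \<longleftrightarrow> (\<exists>v. subseq v u \<and> length u \<le> length v + d \<and> subseq v u')"

text \<open>Infinite words are functions on \<^typ>\<open>nat\<close>, with symbols indexed from 0.\<close>

definition word_prefix :: "(nat \<Rightarrow> 'a) \<Rightarrow> nat \<Rightarrow> 'a list" where
  "word_prefix w m = map w [0..<m]"

definition max_prefix :: "(nat \<Rightarrow> 'a) \<Rightarrow> (nat \<Rightarrow> 'a) \<Rightarrow> nat \<Rightarrow> nat \<Rightarrow> nat" where
  "max_prefix w w' d L = Max {m. subseq_upto d (word_prefix w m) (word_prefix w' L)}"

text \<open>The maximum is over a finite nonempty set, so \<^const>\<open>Max\<close> is meaningful.\<close>

lemma max_prefix_set_subset:
  "{m. subseq_upto d (word_prefix w m) (word_prefix w' L)} \<subseteq> {..L + d}"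
proof
  fix m
  assume "m \<in> {m. subseq_upto d (word_prefix w m) (word_prefix w' L)}"
  then obtain v where "m \<le> length v + d" "subseq v (word_prefix w' L)"
    by (auto simp: subseq_upto_def word_prefix_def)
  moreover from this(2) have "length v \<le> L"
    by (auto dest: list_emb_length simp: word_prefix_def)
  ultimately show "m \<in> {..L + d}" by simp
qed

lemma max_prefix_set_finite: "finite {m. subseq_upto d (word_prefix w m) (word_prefix w' L)}"
  by (rule finite_subset[OF max_prefix_set_subset]) simp

lemma max_prefix_set_zero: "0 \<in> {m. subseq_upto d (word_prefix w m) (word_prefix w' L)}"
  by (auto simp: subseq_upto_def word_prefix_def)

end

theory Submission
  imports Defs
begin

text \<open>Read \<open>w'\<close> symbol by symbol and follow \<open>A = P\<^sub>0\<close> and \<open>B = P\<^sub>1\<close>: a front advances when its next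
  symbol in \<open>w\<close> is read, and \<open>B\<close> is pushed to \<open>A + 1\<close> whenever \<open>A\<close> catches up. If the symbols of \<open>w\<close>
  at \<open>A\<close> and \<open>B\<close> agree, both fronts move together; otherwise the gap \<open>B - A\<close> goes up or down with
  equal probability. So the gap, observed at the steps of the second kind (lone moves), is a simple
  random walk on the positive integers reflected at 1.

  It remains to see that there are many lone moves. Each time \<open>B\<close> is matched, the next symbol of \<open>w\<close>
  is fresh, so with probability \<open>1 - 1/k\<close> it differs from the symbol at \<open>A\<close>, and then the next
  move is a lone one. Such matches occur independently at every step with probability
  \<open>p = (k - 1) / k\<^sup>2\<close>, so up to one there are at least as many lone moves as successes among \<open>L\<close>
  such trials. Stopping the walk after \<open>n = \<lfloor>4pL/5\<rfloor>\<close> lone moves can only decrease the expected gap,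
  and Chebyshev's inequality controls the loss from not reaching \<open>n\<close> lone moves in time.\<close>

section \<open>The mean of reflected simple random walk\<close>

text \<open>A step down from 1 stays at 1, so the walk started at \<open>x\<close> is 1/2 plus the
  absolute value of a simple random walk started at \<open>x - 1/2\<close>. This is where the halves
  in the bounds below come from.\<close>

primrec reflected_mean :: "nat \<Rightarrow> nat \<Rightarrow> real" where
  "reflected_mean 0 x = real x"
| "reflected_mean (Suc m) x =
     (reflected_mean m (Suc x) + reflected_mean m (max 1 (x - 1))) / 2"

text \<open>The walk has no drift except at 1, where a step adds 1/2 on average. The last term is
  therefore half the probability of being at 1 after \<open>m\<close> steps: the free walk must sit
  at 1/2 or -1/2, and parity leaves just one of them.\<close>

lemma reflected_mean_Suc_diff:
  assumes "x \<ge> 1"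
  shows "reflected_mean (Suc m) x =
    reflected_mean m x + real (m choose ((m + x) div 2)) / 2 ^ Suc m"
  using assms
proof (induction m arbitrary: x)
  case 0
  then show ?case
    by (cases "x = 1") (auto simp: max_def binomial_eq_0_iff field_simps)
next
  case (Suc m)
  \<comment> \<open>Conditioning on the first step turns into Pascal's rule; at \<open>x = 1\<close>
    this needs in addition that the two middle coefficients agree.\<close>
  have eq: "(m choose ((m + Suc x) div 2)) + (m choose ((m + max 1 (x - 1)) div 2)) =
    (Suc m choose ((Suc m + x) div 2))"
  proof (cases "x = 1")
    case True
    have "(m choose (Suc m div 2)) = (m choose (m div 2))"
    proof -
      have "m - Suc m div 2 = m div 2" by presburger
      then show ?thesis
        using binomial_symmetric[of "Suc m div 2" m] by simp
    qed
    then show ?thesis using True by simp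
  next
    case False
    then obtain z where z: "x = Suc (Suc z)"
      using Suc.prems by (metis One_nat_def Suc_le_D not0_implies_Suc)
    have "(Suc m + x) div 2 = Suc ((Suc m + z) div 2)" using z by simp
    then show ?thesis using z by (simp add: max_def)
  qed
  have "reflected_mean (Suc (Suc m)) x =
    (reflected_mean (Suc m) (Suc x) + reflected_mean (Suc m) (max 1 (x - 1))) / 2"
    by (rule reflected_mean.simps(2))
  also have "\<dots> = ((reflected_mean m (Suc x) + real (m choose ((m + Suc x) div 2)) / 2 ^ Suc m)
     + (reflected_mean m (max 1 (x - 1))
        + real (m choose ((m + max 1 (x - 1)) div 2)) / 2 ^ Suc m)) / 2"
    using Suc.IH[of "Suc x"] Suc.IH[of "max 1 (x - 1)"] by (simp del: reflected_mean.simps)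
  also have "\<dots> = reflected_mean (Suc m) x +
     real ((m choose ((m + Suc x) div 2)) + (m choose ((m + max 1 (x - 1)) div 2))) / 2 ^ Suc (Suc m)"
    by (simp add: field_simps)
  finally show ?case unfolding eq .
qed

text \<open>The ratio of consecutive coefficients is 2(2j+3)/(j+2), so the induction step comes down
  to 4(j+1)(j+2) \<le> (2j+3)^2.\<close>

lemma odd_central_binomial_ge:
  "16 ^ j \<le> real (j + 1) * real ((2 * j + 1) choose (j + 1)) ^ 2"
proof (induction j)
  case 0
  then show ?case by simp
next
  case (Suc j)
  define a where "a = real ((2 * j + 1) choose (j + 1))"
  define a' where "a' = real ((2 * Suc j + 1) choose (Suc j + 1))"
  have sym: "((2 * j + 1) choose j) = ((2 * j + 1) choose (j + 1))"
    using binomial_symmetric[of j "2 * j + 1"] by simp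
  have "(Suc (2 * j + 1) choose Suc j) = 2 * ((2 * j + 1) choose (j + 1))"
    using sym by simp
  moreover have "Suc (j + 1) * (Suc (2 * j + 2) choose Suc (j + 1)) =
      Suc (2 * j + 2) * ((2 * j + 2) choose (j + 1))"
    by (rule Suc_times_binomial)
  ultimately have "(j + 2) * ((2 * Suc j + 1) choose (Suc j + 1)) =
      (2 * j + 3) * (2 * ((2 * j + 1) choose (j + 1)))"
    by (simp add: numeral_eq_Suc del: binomial_Suc_Suc)
  then have "real ((j + 2) * ((2 * Suc j + 1) choose (Suc j + 1))) =
      real ((2 * j + 3) * (2 * ((2 * j + 1) choose (j + 1))))"
    by (rule arg_cong)
  then have rel: "(real j + 2) * a' = (2 * real j + 3) * (2 * a)"
    unfolding a_def a'_def of_nat_mult of_nat_add of_nat_numeral .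
  have "(real j + 2) * 16 ^ Suc j \<le> (real j + 2) * (16 * ((real j + 1) * a ^ 2))"
    using Suc.IH by (intro mult_left_mono) (simp_all add: a_def add.commute)
  also have "\<dots> = (4 * (real j + 1) * (real j + 2)) * (4 * a ^ 2)"
    by (simp add: algebra_simps)
  also have "\<dots> \<le> (2 * real j + 3) ^ 2 * (4 * a ^ 2)"
    by (intro mult_right_mono) (auto simp: power2_eq_square algebra_simps)
  also have "\<dots> = ((2 * real j + 3) * (2 * a)) ^ 2"
    by (simp add: power_mult_distrib)
  also have "\<dots> = (real j + 2) * ((real j + 2) * a' ^ 2)"
    unfolding rel[symmetric] by (simp add: power_mult_distrib power2_eq_square)
  finally have "16 ^ Suc j \<le> (real j + 2) * a' ^ 2" by simp
  then show ?case unfolding a'_def by (simp add: add.commute)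
qed

text \<open>The odd case is the preceding bound after taking roots. A positive even \<open>m\<close>
  is reduced to \<open>m - 1\<close>, since its central coefficient is twice the one before.\<close>

lemma central_binomial_ge:
  "1 / sqrt (2 * (real m + 1)) \<le> real (m choose ((m + 1) div 2)) / 2 ^ m"
proof -
  define b where "b = real (m choose ((m + 1) div 2))"
  have main: "4 ^ m \<le> 2 * (real m + 1) * b ^ 2"
  proof (cases "even m")
    case False
    then obtain j where m: "m = 2 * j + 1" by (elim oddE)
    have "(4::real) ^ m = 4 * 16 ^ j" by (simp add: m power_mult)
    then show ?thesis
      using odd_central_binomial_ge[of j] by (simp add: m b_def algebra_simps)
  next
    case True
    then obtain j where m: "m = 2 * j" by (elim evenE)
    show ?thesis
    proof (cases j)
      case 0
      then show ?thesis using m by (simp add: b_def)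
    next
      case (Suc i)
      have sym: "((2 * i + 1) choose i) = ((2 * i + 1) choose (i + 1))"
        using binomial_symmetric[of i "2 * i + 1"] by simp
      have "(Suc (2 * i + 1) choose Suc i) = 2 * ((2 * i + 1) choose (i + 1))"
        using sym by simp
      then have b: "b = 2 * real ((2 * i + 1) choose (i + 1))"
        unfolding b_def m Suc by (simp del: binomial_Suc_Suc)
      have "(4::real) ^ m = 16 * 16 ^ i" by (simp add: m Suc power_mult)
      also have "\<dots> \<le> 16 * (real (i + 1) * (b / 2) ^ 2)"
        using odd_central_binomial_ge[of i] unfolding b by (simp del: binomial_Suc_Suc)
      also have "\<dots> \<le> 2 * (real m + 1) * b ^ 2"
        by (simp add: m Suc power_divide algebra_simps)
      finally show ?thesis .
    qed
  qed
  have "2 ^ m = sqrt (4 ^ m)"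
    by (rule real_sqrt_unique[symmetric]) (simp_all add: power2_eq_square power_mult_distrib[symmetric])
  also have "\<dots> \<le> sqrt (2 * (real m + 1) * b ^ 2)"
    using main by (rule real_sqrt_le_mono)
  also have "\<dots> = sqrt (2 * (real m + 1)) * b"
    by (simp add: real_sqrt_mult b_def)
  finally show ?thesis unfolding b_def[symmetric] by (simp add: field_simps)
qed

text \<open>With \<open>s\<close> the square root in the bound, the mean grows by at least 1/(4s)
  per step, and (s + 1/(4s))^2 \<ge> s^2 + 1/2. Equality holds at \<open>n = 1\<close>; at
  \<open>n = 0\<close> the bound is false.\<close>

lemma reflected_mean_one_ge:
  assumes "n \<ge> 1"
  shows "1 / 2 + sqrt ((real n + 1) / 2) \<le> reflected_mean n 1"
  using assms
proof (induction n rule: dec_induct)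
  case base
  then show ?case by simp
next
  case (step n)
  define s where "s = sqrt ((real n + 1) / 2)"
  have s: "s > 0" "s ^ 2 = (real n + 1) / 2" by (simp_all add: s_def)
  have "(real n + 2) / 2 = s ^ 2 + 1 / 2" by (simp add: s field_simps)
  also have "\<dots> \<le> (s + 1 / (4 * s)) ^ 2"
    using s(1) by (simp add: power2_eq_square field_simps)
  finally have "sqrt ((real n + 2) / 2) \<le> s + 1 / (4 * s)"
    using s(1) by (intro real_le_lsqrt) auto
  also have "2 * s = sqrt (2 * (real n + 1))"
    by (rule real_sqrt_unique[symmetric]) (use s in \<open>auto simp: power_mult_distrib\<close>)
  then have "1 / (4 * s) = 1 / sqrt (2 * (real n + 1)) / 2"
    using s(1) by (simp add: field_simps)
  also have "s + \<dots> \<le> s + real (n choose ((n + 1) div 2)) / 2 ^ n / 2"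
    using central_binomial_ge[of n] by simp
  finally show ?case
    using step.IH unfolding reflected_mean_Suc_diff[OF order.refl]
    by (simp add: s_def add.commute)
qed

text \<open>Jensen's inequality: the mean distance from 1/2 is at most the root of the mean square,
  and the mean square grows by exactly 1 per step.\<close>

lemma reflected_mean_le_sqrt:
  assumes "x \<ge> 1"
  shows "reflected_mean m x \<le> 1 / 2 + sqrt ((real x - 1 / 2) ^ 2 + real m)"
  using assms
proof (induction m arbitrary: x)
  case 0
  then show ?case by simp
next
  case (Suc m)
  define y where "y = real x - 1 / 2"
  have up: "reflected_mean m (Suc x) \<le> 1 / 2 + sqrt ((y + 1) ^ 2 + real m)"
    using Suc.IH[of "Suc x"] by (simp add: y_def algebra_simps)
  \<comment> \<open>Reflection does not affect the square: at \<open>x = 1\<close>, staying at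
    distance 1/2 and moving to -1/2 give the same value.\<close>
  have eq: "(real (max 1 (x - 1)) - 1 / 2) ^ 2 = (y - 1) ^ 2"
    using Suc.prems
    by (cases "x = 1") (auto simp: y_def max_def of_nat_diff power2_eq_square algebra_simps)
  have down: "reflected_mean m (max 1 (x - 1)) \<le> 1 / 2 + sqrt ((y - 1) ^ 2 + real m)"
    using Suc.IH[of "max 1 (x - 1)"] unfolding eq by simp
  define p q where "p = sqrt ((y + 1) ^ 2 + real m)" and "q = sqrt ((y - 1) ^ 2 + real m)"
  have pq: "p ^ 2 = (y + 1) ^ 2 + real m" "q ^ 2 = (y - 1) ^ 2 + real m"
    by (simp_all add: p_def q_def)
  have "((p + q) / 2) ^ 2 \<le> (p ^ 2 + q ^ 2) / 2"
    using sum_squares_bound[of p q] by (simp add: power2_eq_square field_simps)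
  also have "\<dots> = y ^ 2 + real (Suc m)"
    unfolding pq by (simp add: power2_eq_square algebra_simps)
  finally have "(p + q) / 2 \<le> sqrt (y ^ 2 + real (Suc m))"
    by (rule real_le_rsqrt)
  then show ?case using up down by (simp add: p_def q_def y_def field_simps)
qed

text \<open>Linear in \<open>m\<close>, so that a shortfall of \<open>m\<close> lone moves costs at
  most a multiple of that shortfall plus a constant.\<close>

lemma reflected_mean_le:
  assumes "x \<ge> 1"
  shows "reflected_mean m x \<le> real x + (real m + 1) / 2"
proof -
  have "sqrt ((real x - 1 / 2) ^ 2 + real m) \<le> sqrt ((real x - 1 / 2) ^ 2) + sqrt (real m)"
    by (rule sqrt_add_le_add_sqrt) auto
  also have "sqrt ((real x - 1 / 2) ^ 2) = real x - 1 / 2"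
    using assms by simp
  also have "sqrt (real m) \<le> (real m + 1) / 2"
    using arith_geo_mean_sqrt[of "real m" 1] by simp
  finally show ?thesis using reflected_mean_le_sqrt[OF assms, of m] by simp
qed

section \<open>Greedy matching with at most one deletion\<close>

primrec front :: "(nat \<Rightarrow> 'a) \<Rightarrow> (nat \<Rightarrow> 'a) \<Rightarrow> nat \<Rightarrow> nat" where
  "front w v 0 = 0"
| "front w v (Suc t) = (if w (front w v t) = v t then Suc (front w v t) else front w v t)"

text \<open>The start value and the second argument of \<open>max\<close> both spend the deletion on
  the symbol at the current \<open>front\<close>; the first argument keeps an earlier
  deletion.\<close>

primrec front1 :: "(nat \<Rightarrow> 'a) \<Rightarrow> (nat \<Rightarrow> 'a) \<Rightarrow> nat \<Rightarrow> nat" where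
  "front1 w v 0 = 1"
| "front1 w v (Suc t) =
     max (if w (front1 w v t) = v t then Suc (front1 w v t) else front1 w v t)
         (Suc (front w v (Suc t)))"

text \<open>A step in which only \<^const>\<open>front\<close> is matched counts even if \<^const>\<open>front1\<close> is pushed ahead
  of it, so that the gap does not change: this is a reflection of the random walk.\<close>

primrec lone_moves :: "(nat \<Rightarrow> 'a) \<Rightarrow> (nat \<Rightarrow> 'a) \<Rightarrow> nat \<Rightarrow> nat" where
  "lone_moves w v 0 = 0"
| "lone_moves w v (Suc t) = lone_moves w v t +
     of_bool (w (front w v t) \<noteq> w (front1 w v t) \<and>
       (v t = w (front w v t) \<or> v t = w (front1 w v t)))"

text \<open>When \<open>front1\<close> is matched it moves to exactly
  \<open>Suc (front1 w v t)\<close>, because the new \<open>front\<close> is at most the old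
  \<open>front1\<close>. So the second condition compares the symbols at the two new fronts.\<close>

primrec fresh_moves :: "(nat \<Rightarrow> 'a) \<Rightarrow> (nat \<Rightarrow> 'a) \<Rightarrow> nat \<Rightarrow> nat" where
  "fresh_moves w v 0 = 0"
| "fresh_moves w v (Suc t) = fresh_moves w v t +
     of_bool (v t = w (front1 w v t) \<and> w (Suc (front1 w v t)) \<noteq> w (front w v (Suc t)))"

lemma front_less_front1: "front w v t < front1 w v t"
  by (cases t) auto

lemma front1_le: "front1 w v t \<le> Suc t"
proof (induction t)
  case (Suc t)
  then show ?case using front_less_front1[of w v t] by auto
qed simp

text \<open>This is the independence used in the averaging: \<open>v t\<close> and the symbol of
  \<open>w\<close> just after \<open>front1 w v t\<close> can be resampled without changing the
  state at time \<open>t\<close>.\<close>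

lemma fronts_cong:
  assumes "\<And>i. i \<le> front1 w v t \<Longrightarrow> w2 i = w i" and "\<And>i. i < t \<Longrightarrow> v2 i = v i"
  shows "front w2 v2 t = front w v t \<and> front1 w2 v2 t = front1 w v t \<and>
    lone_moves w2 v2 t = lone_moves w v t \<and> fresh_moves w2 v2 t = fresh_moves w v t"
  using assms
proof (induction t)
  case (Suc t)
  have le: "front1 w v t \<le> front1 w v (Suc t)" by auto
  have IH: "front w2 v2 t = front w v t" "front1 w2 v2 t = front1 w v t"
    "lone_moves w2 v2 t = lone_moves w v t" "fresh_moves w2 v2 t = fresh_moves w v t"
    using Suc.IH Suc.prems le by (auto simp del: front.simps front1.simps)
  have v: "v2 t = v t" using Suc.prems by simp
  have a: "w2 (front w v t) = w (front w v t)" "w2 (front1 w v t) = w (front1 w v t)"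
    using Suc.prems(1) le front_less_front1[of w v t]
    by (auto simp del: front.simps front1.simps)
  have f: "front w2 v2 (Suc t) = front w v (Suc t)" by (simp add: IH v a)
  have f1: "front1 w2 v2 (Suc t) = front1 w v (Suc t)"
    by (simp add: IH v a f del: front.simps)
  have af: "w2 (front w v (Suc t)) = w (front w v (Suc t))"
    using Suc.prems(1) front_less_front1[of w v "Suc t"] by simp
  \<comment> \<open>The symbol beyond \<open>front1\<close> is inspected only after a match, and
    then it lies in the range where the words agree.\<close>
  have "w2 (Suc (front1 w v t)) = w (Suc (front1 w v t))" if "v t = w (front1 w v t)"
  proof -
    have "Suc (front1 w v t) \<le> front1 w v (Suc t)" using that by auto
    then show ?thesis using Suc.prems(1) by blast
  qed
  then have "fresh_moves w2 v2 (Suc t) = fresh_moves w v (Suc t)"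
    by (auto simp add: IH v a f af simp del: front.simps front1.simps)
  moreover have "lone_moves w2 v2 (Suc t) = lone_moves w v (Suc t)"
    by (simp add: IH v a)
  ultimately show ?case using f f1 by blast
qed simp

text \<open>A fresh move leaves different symbols at the two fronts, and this persists until the
  next lone move. The indicator records a lone move that is still owed.\<close>

lemma fresh_moves_le_lone_moves:
  "fresh_moves w v t \<le> lone_moves w v t + of_bool (w (front w v t) \<noteq> w (front1 w v t))"
proof (induction t)
  case (Suc t)
  have "max (Suc (front1 w v t)) (Suc (Suc (front w v t))) = Suc (front1 w v t)"
    "max (Suc (front1 w v t)) (Suc (front w v t)) = Suc (front1 w v t)"
    "max (front1 w v t) (Suc (front w v t)) = front1 w v t"
    using front_less_front1[of w v t] by auto
  with Suc show ?case
    by (cases "v t = w (front w v t)"; cases "v t = w (front1 w v t)") auto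
qed simp

section \<open>Comparison of the fronts with \<open>max_prefix\<close>\<close>

lemma word_prefix_Suc: "word_prefix w (Suc m) = word_prefix w m @ [w m]"
  by (simp add: word_prefix_def)

lemma subseq_snoc_snoc_iff:
  "subseq (xs @ [x]) (ys @ [y]) \<longleftrightarrow> (if x = y then subseq xs ys else subseq (xs @ [x]) ys)"
proof (cases "x = y")
  case True
  then show ?thesis by simp
next
  case False
  have "subseq (xs @ [x]) ys" if "subseq (xs @ [x]) (ys @ [y])"
    using that
  proof (cases rule: subseq_appendE)
    case (append us vs)
    show ?thesis
    proof (cases vs rule: rev_cases)
      case Nil
      then show ?thesis using append by simp
    next
      case (snoc zs z)
      then have "subseq (zs @ [x]) [y]" using append by simp
      then have "x \<in> set [y]" by (rule list_emb_set) auto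
      then show ?thesis using False by simp
    qed
  qed
  then show ?thesis using False subseq_rev_drop_many by auto
qed

lemma subseq_front: "subseq (word_prefix w (front w v t)) (word_prefix v t)"
proof (induction t)
  case 0
  then show ?case by (simp add: word_prefix_def)
next
  case (Suc t)
  then show ?case by (simp add: word_prefix_Suc subseq_rev_drop_many)
qed

text \<open>Greedy matching is optimal. If symbol \<open>n\<close> is matched to the last one read,
  then either \<open>front\<close> is already beyond \<open>n\<close>, or it equals \<open>n\<close>
  and advances as well.\<close>

lemma subseq_prefix_le_front:
  assumes "subseq (word_prefix w m) (word_prefix v t)"
  shows "m \<le> front w v t"
  using assms
proof (induction t arbitrary: m)
  case 0
  then show ?case by (auto dest: list_emb_length simp: word_prefix_def)
next
  case (Suc t)
  show ?case
  proof (cases m)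
    case (Suc n)
    have "(if w n = v t then n \<le> front w v t else Suc n \<le> front w v t)"
      using Suc.prems Suc.IH[of n] Suc.IH[of "Suc n"]
      unfolding Suc word_prefix_Suc subseq_snoc_snoc_iff by (auto split: if_splits)
    then show ?thesis using Suc by (auto split: if_splits simp: le_less)
  qed simp
qed

text \<open>Both arguments of \<open>max\<close> are feasible: a match extends the embedding at
  hand, and a push deletes the symbol following the prefix matched in full.\<close>

lemma subseq_upto_front1: "subseq_upto 1 (word_prefix w (front1 w v t)) (word_prefix v t)"
proof -
  have drop: "subseq_upto 1 (word_prefix w (Suc (front w v t))) (word_prefix v t)" for t
    unfolding subseq_upto_def
    by (rule exI[of _ "word_prefix w (front w v t)"])
      (simp add: word_prefix_Suc subseq_front subseq_rev_drop_many)
  show ?thesis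
  proof (induction t)
    case 0
    then show ?case using drop[of 0] by simp
  next
    case (Suc t)
    then obtain u where u: "subseq u (word_prefix w (front1 w v t))"
      "length (word_prefix w (front1 w v t)) \<le> length u + 1" "subseq u (word_prefix v t)"
      unfolding subseq_upto_def by auto
    have match: "subseq_upto 1
        (word_prefix w (if w (front1 w v t) = v t then Suc (front1 w v t) else front1 w v t))
        (word_prefix v (Suc t))"
    proof (cases "w (front1 w v t) = v t")
      case True
      then show ?thesis
        using u unfolding subseq_upto_def
        by (intro exI[of _ "u @ [v t]"]) (simp add: word_prefix_Suc subseq_snoc_snoc_iff)
    next
      case False
      then show ?thesis
        using u unfolding subseq_upto_def
        by (intro exI[of _ u]) (auto simp: word_prefix_Suc)
    qed
    then show ?case using drop[of "Suc t"] by (auto simp: max_def simp del: front.simps)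
  qed
qed

text \<open>For a lower bound on the difference, \<open>front1\<close> has to be feasible and
  \<open>front\<close> has to be optimal.\<close>

lemma front1_minus_front_le:
  "real (front1 w v L) - real (front w v L)
     \<le> real (max_prefix w v 1 L) - real (max_prefix w v 0 L)"
proof -
  have "front1 w v L \<le> max_prefix w v 1 L"
    unfolding max_prefix_def
    by (rule Max_ge[OF max_prefix_set_finite]) (simp add: subseq_upto_front1[simplified])
  moreover have "max_prefix w v 0 L \<in> {m. subseq_upto 0 (word_prefix w m) (word_prefix v L)}"
    unfolding max_prefix_def
    by (rule Max_in[OF max_prefix_set_finite]) (use max_prefix_set_zero in blast)
  then obtain u where u: "subseq u (word_prefix w (max_prefix w v 0 L))"
    "length (word_prefix w (max_prefix w v 0 L)) \<le> length u" "subseq u (word_prefix v L)"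
    by (auto simp: subseq_upto_def)
  then have "u = word_prefix w (max_prefix w v 0 L)"
    using list_emb_length[OF u(1)] by (intro subseq_same_length) auto
  then have "subseq (word_prefix w (max_prefix w v 0 L)) (word_prefix v L)"
    using u(3) by simp
  then have "max_prefix w v 0 L \<le> front w v L" by (rule subseq_prefix_le_front)
  ultimately show ?thesis by simp
qed

text \<open>Every admissible length is at most \<open>L + d\<close>, so finitely many symbols decide
  the maximum.\<close>

lemma max_prefix_cong:
  assumes "\<And>i. i < L + d \<Longrightarrow> w2 i = w i" and "\<And>i. i < L \<Longrightarrow> v2 i = v i"
  shows "max_prefix w2 v2 d L = max_prefix w v d L"
proof -
  have v: "word_prefix v2 L = word_prefix v L" using assms(2) by (simp add: word_prefix_def)
  have w: "word_prefix w2 m = word_prefix w m" if "m \<le> L + d" for m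
    using assms(1) that by (simp add: word_prefix_def)
  have "{m. subseq_upto d (word_prefix w2 m) (word_prefix v2 L)} =
    {m. subseq_upto d (word_prefix w m) (word_prefix v L)}"
    using max_prefix_set_subset[of d w2 v2 L] max_prefix_set_subset[of d w v L] w v
    by (auto simp: subset_iff)
  then show ?thesis by (simp add: max_prefix_def)
qed

section \<open>Averaging over words\<close>

text \<open>The resampled coordinate may depend on the word, as long as resampling does not change it:
  then exchanging the old and the new symbol is an involution.\<close>

lemma sum_PiE_resample:
  fixes f :: "('i \<Rightarrow> 'b) \<Rightarrow> real"
  assumes "finite J" "finite K"
    and "\<And>y. y \<in> PiE J (\<lambda>_. K) \<Longrightarrow> j y \<in> J"
    and "\<And>y c. y \<in> PiE J (\<lambda>_. K) \<Longrightarrow> c \<in> K \<Longrightarrow> j (y(j y := c)) = j y"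
  shows "(\<Sum>y\<in>PiE J (\<lambda>_. K). \<Sum>c\<in>K. f (y(j y := c))) = real (card K) * (\<Sum>y\<in>PiE J (\<lambda>_. K). f y)"
proof -
  let ?S = "PiE J (\<lambda>_. K)"
  define \<phi> where "\<phi> = (\<lambda>(y, c). (y(j y := c), y (j y)))"
  have mem: "\<phi> p \<in> ?S \<times> K" if "p \<in> ?S \<times> K" for p
    using that assms(3) by (auto simp: \<phi>_def PiE_iff extensional_def)
  have inv: "\<phi> (\<phi> p) = p" if "p \<in> ?S \<times> K" for p
    using that assms(4) by (auto simp: \<phi>_def)
  have "(\<Sum>y\<in>?S. \<Sum>c\<in>K. f (y(j y := c))) = (\<Sum>p\<in>?S \<times> K. f (fst (\<phi> p)))"
    by (simp add: sum.cartesian_product \<phi>_def case_prod_beta)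
  also have "\<dots> = (\<Sum>p\<in>?S \<times> K. f (fst p))"
    by (rule sum.reindex_bij_witness[where i = \<phi> and j = \<phi>]) (use mem inv in auto)
  also have "\<dots> = (\<Sum>y\<in>?S. \<Sum>c\<in>K. f y)"
    by (subst sum.cartesian_product) (simp add: case_prod_beta)
  also have "\<dots> = real (card K) * (\<Sum>y\<in>?S. f y)"
    by (simp add: sum_distrib_left)
  finally show ?thesis .
qed

text \<open>Reduces the probability space to counting: a function of finitely many uniform symbols
  is averaged over all their values.\<close>

lemma (in prob_space) expectation_uniform_coords:
  fixes X :: "'i \<Rightarrow> 'a \<Rightarrow> 'b :: countable" and F :: "('i \<Rightarrow> 'b) \<Rightarrow> real"
  assumes indep: "indep_vars (\<lambda>_. count_space UNIV) X UNIV"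
    and J: "finite J" "J \<noteq> {}" and K: "finite K" "K \<noteq> {}"
    and distr: "\<And>s. distr M (count_space UNIV) (X s) = measure_pmf (pmf_of_set K)"
    and F: "\<And>x. F (restrict x J) = F x"
  shows "expectation (\<lambda>\<omega>. F (\<lambda>s. X s \<omega>)) = (\<Sum>y\<in>PiE J (\<lambda>_. K). F y) / real (card K) ^ card J"
proof -
  let ?S = "PiE J (\<lambda>_. K)"
  have X[measurable]: "X s \<in> measurable M (count_space UNIV)" for s
    using indep by (auto simp: indep_vars_def)
  define E where "E y = (\<Inter>s\<in>J. X s -` {y s} \<inter> space M)" for y
  have restrict_eq: "restrict x J = y \<longleftrightarrow> (\<forall>s\<in>J. x s = y s)" if "y \<in> PiE J A" for x y and A :: "'i \<Rightarrow> 'b set"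
    using that by (auto simp: PiE_iff intro!: extensionalityI[of _ J])
  have E_sets: "E y \<in> events" for y
    unfolding E_def using J by (intro sets.finite_INT) auto
  have prob1: "prob (X s -` A \<inter> space M) = measure (measure_pmf (pmf_of_set K)) A" for s A
    unfolding distr[of s, symmetric] by (subst measure_distr) auto
  have prob_E: "prob (E y) = 1 / real (card K) ^ card J" if "y \<in> ?S" for y
  proof -
    have "prob (E y) = (\<Prod>s\<in>J. prob (X s -` {y s} \<inter> space M))"
      unfolding E_def using J by (intro indep_varsD[OF indep]) auto
    also have "\<dots> = (\<Prod>s\<in>J. 1 / real (card K))"
      using that K by (intro prod.cong refl) (auto simp: prob1 measure_pmf_single indicator_def dest: PiE_mem)
    finally show ?thesis by (simp add: power_divide)
  qed
  have "AE \<omega> in M. X s \<omega> \<in> K" for s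
  proof -
    have "prob (X s -` K \<inter> space M) = 1"
      using K by (simp add: prob1 measure_pmf_of_set)
    then have "AE \<omega> in M. \<omega> \<in> X s -` K \<inter> space M"
      by (subst (asm) prob_eq_1) auto
    then show ?thesis by eventually_elim auto
  qed
  then have AE_K: "AE \<omega> in M. \<forall>s\<in>J. X s \<omega> \<in> K"
    using J(1) by (simp add: AE_finite_all)
  \<comment> \<open>The restricted word has countably many possible values, so measurability can be
    checked on the events \<open>E y\<close>.\<close>
  have "countable (PiE J (\<lambda>_. UNIV :: 'b set))" using J by (intro countable_PiE) auto
  note eq_countable = measurable_count_space_eq_countable[OF this]
  have "(\<lambda>\<omega>. restrict (\<lambda>s. X s \<omega>) J) \<in> measurable M (count_space (PiE J (\<lambda>_. UNIV)))"
    unfolding eq_countable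
  proof (intro conjI ballI)
    fix y :: "'i \<Rightarrow> 'b" assume "y \<in> PiE J (\<lambda>_. UNIV)"
    then have "(\<lambda>\<omega>. restrict (\<lambda>s. X s \<omega>) J) -` {y} \<inter> space M = E y"
      using J by (auto simp: restrict_eq E_def)
    then show "(\<lambda>\<omega>. restrict (\<lambda>s. X s \<omega>) J) -` {y} \<inter> space M \<in> events"
      using E_sets by simp
  qed auto
  then have "(\<lambda>\<omega>. F (restrict (\<lambda>s. X s \<omega>) J)) \<in> borel_measurable M"
    by (rule measurable_compose) simp
  then have FX: "(\<lambda>\<omega>. F (\<lambda>s. X s \<omega>)) \<in> borel_measurable M" by (simp add: F)
  have fin: "finite ?S" using J K by (simp add: finite_PiE)
  have "expectation (\<lambda>\<omega>. F (\<lambda>s. X s \<omega>)) = expectation (\<lambda>\<omega>. \<Sum>y\<in>?S. F y * indicator (E y) \<omega>)"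
  proof (rule integral_cong_AE)
    show "AE \<omega> in M. F (\<lambda>s. X s \<omega>) = (\<Sum>y\<in>?S. F y * indicator (E y) \<omega>)"
      using AE_K AE_space
    proof eventually_elim
      case (elim \<omega>)
      define z where "z = restrict (\<lambda>s. X s \<omega>) J"
      have z: "z \<in> ?S" using elim by (auto simp: z_def)
      have ind: "\<omega> \<in> E y \<longleftrightarrow> z = y" if "y \<in> ?S" for y
        using that elim J
        unfolding z_def restrict_eq[OF that] by (auto simp: E_def)
      have "(\<Sum>y\<in>?S. F y * indicator (E y) \<omega>) = (\<Sum>y\<in>?S. if z = y then F y else 0)"
        using ind by (intro sum.cong refl) (auto simp: indicator_def)
      also have "\<dots> = F z" using z fin by simp
      finally show ?case by (simp add: z_def F)
    qed
  qed (use FX E_sets in auto)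
  also have "\<dots> = (\<Sum>y\<in>?S. F y * prob (E y))"
    using E_sets
    by (subst Bochner_Integration.integral_sum) (auto simp: less_top[symmetric])
  also have "\<dots> = (\<Sum>y\<in>?S. F y / real (card K) ^ card J)"
    by (intro sum.cong refl) (simp add: prob_E)
  finally show ?thesis by (simp add: sum_divide_distrib)
qed

section \<open>One-step estimates for a uniformly chosen symbol\<close>

lemma sum_two_exceptions:
  fixes p q r :: real
  assumes "finite K" "a \<in> K" "b \<in> K" "a \<noteq> b"
  shows "(\<Sum>c\<in>K. if c = a then p else if c = b then q else r) = p + q + (real (card K) - 2) * r"
proof -
  have "(\<Sum>c\<in>K. if c = a then p else if c = b then q else r) =
    (\<Sum>c\<in>K. r + (if c = a then p - r else 0) + (if c = b then q - r else 0))"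
    using assms(4) by (intro sum.cong) auto
  also have "\<dots> = real (card K) * r + (p - r) + (q - r)"
    using assms(1-3) by (simp add: sum.distrib)
  finally show ?thesis by (simp add: algebra_simps)
qed

text \<open>The gap between the fronts, run for \<open>m\<close> lone moves in total, is a reflected simple random
  walk; this is its conditional expected final value.\<close>

definition gap_potential :: "nat \<Rightarrow> (nat \<Rightarrow> 'a) \<Rightarrow> (nat \<Rightarrow> 'a) \<Rightarrow> nat \<Rightarrow> real" where
  "gap_potential m w v t = reflected_mean (m - lone_moves w v t) (front1 w v t - front w v t)"

text \<open>The submartingale property. With equal symbols the fronts move together or not at all;
  otherwise one symbol of \<open>K\<close> narrows the gap, one widens it, and the rest change
  nothing.\<close>

lemma gap_potential_step:
  assumes "finite K" "w (front w v t) \<in> K" "w (front1 w v t) \<in> K"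
  shows "real (card K) * gap_potential m w v t \<le> (\<Sum>c\<in>K. gap_potential m w (v(t := c)) (Suc t))"
proof -
  define A B N where "A = front w v t" and "B = front1 w v t" and "N = lone_moves w v t"
  have AB: "A < B" using front_less_front1 by (simp add: A_def B_def)
  have cong: "front w (v(t := c)) t = A" "front1 w (v(t := c)) t = B"
    "lone_moves w (v(t := c)) t = N" for c
    using fronts_cong[of w v t w "v(t := c)"] by (simp_all add: A_def B_def N_def)
  have pot: "gap_potential m w v t = reflected_mean (m - N) (B - A)"
    by (simp add: gap_potential_def A_def B_def N_def)
  show ?thesis
  proof (cases "w A = w B")
    case True
    have "max (Suc B) (Suc (Suc A)) - Suc A = B - A" "max B (Suc A) - A = B - A"
      using AB by auto
    then have "gap_potential m w (v(t := c)) (Suc t) = gap_potential m w v t" for c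
      using True unfolding pot by (auto simp: gap_potential_def cong)
    then show ?thesis by simp
  next
    case False
    let ?p = "reflected_mean (m - Suc N) (max 1 (B - A - 1))"
    let ?q = "reflected_mean (m - Suc N) (Suc (B - A))"
    have step: "gap_potential m w (v(t := c)) (Suc t) =
      (if c = w A then ?p else if c = w B then ?q else reflected_mean (m - N) (B - A))" for c
    proof -
      have "max B (Suc (Suc A)) - Suc A = max 1 (B - A - 1)"
        "max (Suc B) (Suc A) - A = Suc (B - A)" "max B (Suc A) - A = B - A"
        using AB by auto
      then show ?thesis using False by (auto simp: gap_potential_def cong)
    qed
    \<comment> \<open>While lone moves remain this is the recursion, with equality. Afterwards
      truncated subtraction keeps the first argument at 0, and the gap itself does not decrease on
      average, thanks to the reflection.\<close>
    have "2 * reflected_mean (m - N) (B - A) \<le> ?p + ?q"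
    proof (cases "m - N")
      case 0
      moreover have "2 * (B - A) \<le> max 1 (B - A - 1) + Suc (B - A)"
        using AB by auto
      then have "2 * real (B - A) \<le> real (max 1 (B - A - 1)) + real (Suc (B - A))"
        by linarith
      ultimately show ?thesis by simp
    next
      case (Suc n)
      then have "m - Suc N = n" by simp
      then show ?thesis unfolding Suc by simp
    qed
    then show ?thesis
      using assms False
      unfolding step pot A_def[symmetric] B_def[symmetric]
      by (subst sum_two_exceptions) (simp_all add: algebra_simps)
  qed
qed

text \<open>The new \<open>front\<close> is at most \<open>front1 w v t\<close>, so the symbol with
  which \<open>d\<close> is compared is not the replaced one.\<close>

lemma fresh_moves_upd:
  "fresh_moves (w(Suc (front1 w v t) := d)) (v(t := c)) (Suc t) = fresh_moves w v t +
     of_bool (c = w (front1 w v t) \<and> d \<noteq> w (front w (v(t := c)) (Suc t)))"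
proof -
  let ?w = "w(Suc (front1 w v t) := d)" and ?v = "v(t := c)"
  have cong: "front ?w ?v t = front w v t" "front1 ?w ?v t = front1 w v t"
    "fresh_moves ?w ?v t = fresh_moves w v t" "front w ?v t = front w v t"
    using fronts_cong[of w v t ?w ?v] fronts_cong[of w v t w ?v] by simp_all
  have "front w v t < front1 w v t" by (rule front_less_front1)
  then show ?thesis by (auto simp: cong)
qed

text \<open>Given the past, a fresh move has probability exactly \<open>p\<close>, so the centred
  second moment grows by p(1 - p) \<le> p.\<close>

lemma fresh_moves_step:
  fixes w v :: "nat \<Rightarrow> 'a"
  assumes "finite K" "\<And>i. i \<le> front1 w v t \<Longrightarrow> w i \<in> K"
  defines "p \<equiv> (real (card K) - 1) / real (card K) ^ 2"
  shows "(\<Sum>c\<in>K. \<Sum>d\<in>K.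
      (real (fresh_moves (w(Suc (front1 w v t) := d)) (v(t := c)) (Suc t)) - p * real (Suc t))\<^sup>2)
    \<le> real (card K) ^ 2 * ((real (fresh_moves w v t) - p * real t)\<^sup>2 + p)"
proof -
  define k where "k = real (card K)"
  have front1_in: "w (front1 w v t) \<in> K" by (simp add: assms(2))
  have "card K > 0" using assms(1) front1_in by (auto simp: card_gt_0_iff)
  then have k: "k > 0" by (simp add: k_def)
  have kp: "k ^ 2 * p = k - 1" using k by (simp add: p_def k_def[symmetric])
  define x where "x = real (fresh_moves w v t) - p * real t"
  define g where "g c = w (front w (v(t := c)) (Suc t))" for c
  define I :: "'a \<Rightarrow> 'a \<Rightarrow> real" where "I c d = of_bool (c = w (front1 w v t) \<and> d \<noteq> g c)" for c d
  have g: "g c \<in> K" for c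
  proof -
    have "front w (v(t := c)) t = front w v t"
      using fronts_cong[of w v t w "v(t := c)"] by simp
    then have "front w (v(t := c)) (Suc t) \<le> front1 w v t"
      using front_less_front1[of w v t] by auto
    then show ?thesis unfolding g_def by (rule assms(2))
  qed
  have "(\<Sum>c\<in>K. \<Sum>d\<in>K. I c d) = (\<Sum>c\<in>K. if c = w (front1 w v t) then k - 1 else 0)"
  proof (intro sum.cong refl)
    fix c
    have "(\<Sum>d\<in>K. of_bool (d \<noteq> g c) :: real) = (\<Sum>d\<in>K. 1 - of_bool (d = g c))"
      by (intro sum.cong) auto
    also have "\<dots> = k - 1"
      using assms(1) g[of c] by (simp add: sum_subtractf k_def of_bool_def)
    finally show "(\<Sum>d\<in>K. I c d) = (if c = w (front1 w v t) then k - 1 else 0)"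
      by (cases "c = w (front1 w v t)") (simp_all add: I_def)
  qed
  then have sumI: "(\<Sum>c\<in>K. \<Sum>d\<in>K. I c d) = k - 1"
    using assms(1) front1_in by simp
  \<comment> \<open>The square is affine in \<open>I c d\<close>, as this is 0 or 1; hence the sum
    of \<open>I\<close> is all that is needed.\<close>
  have "(real (fresh_moves (w(Suc (front1 w v t) := d)) (v(t := c)) (Suc t)) - p * real (Suc t))\<^sup>2
     = (x - p)\<^sup>2 + (2 * (x - p) + 1) * I c d" for c d
    unfolding fresh_moves_upd g_def[symmetric]
    by (cases "c = w (front1 w v t) \<and> d \<noteq> g c")
      (auto simp: I_def x_def power2_eq_square algebra_simps)
  then have "(\<Sum>c\<in>K. \<Sum>d\<in>K.
      (real (fresh_moves (w(Suc (front1 w v t) := d)) (v(t := c)) (Suc t)) - p * real (Suc t))\<^sup>2)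
    = k ^ 2 * (x - p)\<^sup>2 + (2 * (x - p) + 1) * (k - 1)"
    by (simp add: sum.distrib sum_distrib_left[symmetric] sumI k_def[symmetric] power2_eq_square)
  also have "\<dots> = k ^ 2 * (x ^ 2 + p - p ^ 2)"
    unfolding kp[symmetric] by (simp add: power2_eq_square algebra_simps)
  also have "\<dots> \<le> k ^ 2 * (x ^ 2 + p)"
    by (intro mult_left_mono) auto
  finally show ?thesis by (simp only: x_def k_def)
qed

section \<open>Sums over all pairs of words\<close>

abbreviation word_coords :: "nat \<Rightarrow> (nat + nat) set" where
  "word_coords L \<equiv> Inl ` {..Suc L} \<union> Inr ` {..<L}"

abbreviation word_pairs :: "nat \<Rightarrow> 'a set \<Rightarrow> (nat + nat \<Rightarrow> 'a) set" where
  "word_pairs L K \<equiv> PiE (word_coords L) (\<lambda>_. K)"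

lemma upd_comp_Inl_Inr:
  "y(Inr t := c) \<circ> Inl = y \<circ> Inl" "y(Inr t := c) \<circ> Inr = (y \<circ> Inr)(t := c)"
  "y(Inl s := d) \<circ> Inl = (y \<circ> Inl)(s := d)" "y(Inl s := d) \<circ> Inr = y \<circ> Inr"
  by (auto simp: fun_eq_iff)

lemma word_pairs_symbol:
  assumes "y \<in> word_pairs L K" "i \<le> Suc L"
  shows "(y \<circ> Inl) i \<in> K"
  using assms by auto

text \<open>Initially the gap is 1 and no lone move has been made, so the potential is
  \<open>reflected_mean m 1\<close>; resampling the symbol read at each step shows that its sum does
  not decrease.\<close>

lemma sum_gap_potential_ge:
  assumes "finite K" "K \<noteq> {}" "t \<le> L"
  shows "real (card (word_pairs L K)) * reflected_mean m 1
    \<le> (\<Sum>y\<in>word_pairs L K. gap_potential m (y \<circ> Inl) (y \<circ> Inr) t)"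
  using assms(3)
proof (induction t)
  case 0
  then show ?case by (simp add: gap_potential_def)
next
  case (Suc t)
  let ?S = "word_pairs L K" and ?k = "real (card K)"
  have k: "?k > 0" using assms by (simp add: card_gt_0_iff)
  have "?k * (\<Sum>y\<in>?S. gap_potential m (y \<circ> Inl) (y \<circ> Inr) t)
    \<le> (\<Sum>y\<in>?S. \<Sum>c\<in>K. gap_potential m (y \<circ> Inl) ((y \<circ> Inr)(t := c)) (Suc t))"
    unfolding sum_distrib_left
  proof (intro sum_mono gap_potential_step assms(1) word_pairs_symbol)
    fix y :: "nat + nat \<Rightarrow> 'a"
    have "front1 (y \<circ> Inl) (y \<circ> Inr) t \<le> Suc L"
      using front1_le[of "y \<circ> Inl" "y \<circ> Inr" t] Suc.prems by simp
    then show "front1 (y \<circ> Inl) (y \<circ> Inr) t \<le> Suc L" "front (y \<circ> Inl) (y \<circ> Inr) t \<le> Suc L"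
      using front_less_front1[of "y \<circ> Inl" "y \<circ> Inr" t] by auto
  qed
  also have "\<dots> = ?k * (\<Sum>y\<in>?S. gap_potential m (y \<circ> Inl) (y \<circ> Inr) (Suc t))"
    using sum_PiE_resample[of "word_coords L" K "\<lambda>_. Inr t"
        "\<lambda>y. gap_potential m (y \<circ> Inl) (y \<circ> Inr) (Suc t)"] assms(1) Suc.prems
    by (simp only: upd_comp_Inl_Inr) auto
  finally have "(\<Sum>y\<in>?S. gap_potential m (y \<circ> Inl) (y \<circ> Inr) t)
    \<le> (\<Sum>y\<in>?S. gap_potential m (y \<circ> Inl) (y \<circ> Inr) (Suc t))"
    using k by simp
  then show ?case by (rule order_trans[OF Suc.IH[OF Suc_leD[OF Suc.prems]]])
qed

text \<open>The second-moment half of Chebyshev's inequality, with \<open>p * t\<close> bounding the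
  variance of a sum of \<open>t\<close> trials.\<close>

lemma sum_fresh_moves_variance_le:
  fixes K :: "'a set"
  assumes "finite K" "K \<noteq> {}" "t \<le> L"
  defines "p \<equiv> (real (card K) - 1) / real (card K) ^ 2"
  shows "(\<Sum>y\<in>word_pairs L K. (real (fresh_moves (y \<circ> Inl) (y \<circ> Inr) t) - p * real t)\<^sup>2)
    \<le> real (card (word_pairs L K)) * (p * real t)"
  using assms(3)
proof (induction t)
  case 0
  then show ?case by simp
next
  case (Suc t)
  let ?S = "word_pairs L K" and ?k = "real (card K)"
  have k: "?k > 0" using assms by (simp add: card_gt_0_iff)
  define B where "B y = front1 (y \<circ> Inl) (y \<circ> Inr) t" for y :: "nat + nat \<Rightarrow> 'a"
  define V where "V y = (real (fresh_moves (y \<circ> Inl) (y \<circ> Inr) (Suc t)) - p * real (Suc t))\<^sup>2"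
    for y :: "nat + nat \<Rightarrow> 'a"
  \<comment> \<open>Thus the resampled position \<open>Suc (B y)\<close> is at most
    \<open>Suc L\<close>, which is why \<open>word_coords\<close> extends that far.\<close>
  have B_le: "B y \<le> L" for y
    using front1_le[of "y \<circ> Inl" "y \<circ> Inr" t] Suc.prems by (simp add: B_def)
  have B_upd: "B (y(Inl (Suc (B y)) := d)) = B y" "B (y(Inr t := c)) = B y" for y c d
    unfolding B_def upd_comp_Inl_Inr
    by (rule fronts_cong[THEN conjunct2, THEN conjunct1]; simp)+
  \<comment> \<open>Two resamplings, each contributing a factor \<open>?k\<close>: here the symbol
    after \<open>front1\<close>, whose position depends on the word, and next the symbol read at
    time \<open>t\<close>.\<close>
  have "?k ^ 2 * (\<Sum>y\<in>?S. V y) = ?k * (\<Sum>y\<in>?S. \<Sum>d\<in>K. V (y(Inl (Suc (B y)) := d)))"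
    using assms(1) B_le B_upd
    by (subst sum_PiE_resample) (auto simp: power2_eq_square)
  also have "\<dots> = (\<Sum>y\<in>?S. \<Sum>c\<in>K. \<Sum>d\<in>K. V ((y(Inr t := c))(Inl (Suc (B y)) := d)))"
    using sum_PiE_resample[of "word_coords L" K "\<lambda>_. Inr t"
        "\<lambda>y. \<Sum>d\<in>K. V (y(Inl (Suc (B y)) := d))"] assms(1) Suc.prems
    by (simp only: B_upd) auto
  also have "\<dots> \<le> (\<Sum>y\<in>?S. ?k ^ 2 *
      ((real (fresh_moves (y \<circ> Inl) (y \<circ> Inr) t) - p * real t)\<^sup>2 + p))"
  proof (rule sum_mono)
    fix y assume y: "y \<in> ?S"
    have "(y \<circ> Inl) i \<in> K" if "i \<le> B y" for i
      using word_pairs_symbol[OF y, of i] that B_le[of y] by simp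
    then show "(\<Sum>c\<in>K. \<Sum>d\<in>K. V ((y(Inr t := c))(Inl (Suc (B y)) := d)))
      \<le> ?k ^ 2 * ((real (fresh_moves (y \<circ> Inl) (y \<circ> Inr) t) - p * real t)\<^sup>2 + p)"
      unfolding V_def B_def upd_comp_Inl_Inr p_def
      by (intro fresh_moves_step assms(1)) auto
  qed
  also have "\<dots> = ?k ^ 2 * ((\<Sum>y\<in>?S. (real (fresh_moves (y \<circ> Inl) (y \<circ> Inr) t) - p * real t)\<^sup>2)
      + real (card ?S) * p)"
    by (simp add: sum_distrib_left[symmetric] sum.distrib)
  also have "\<dots> \<le> ?k ^ 2 * (real (card ?S) * (p * real t) + real (card ?S) * p)"
    using Suc.prems by (intro mult_left_mono add_right_mono Suc.IH) auto
  also have "\<dots> = ?k ^ 2 * (real (card ?S) * (p * real (Suc t)))"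
    by (simp add: algebra_simps)
  finally have "(\<Sum>y\<in>?S. V y) \<le> real (card ?S) * (p * real (Suc t))"
    by (rule mult_left_le_imp_le) (use k in simp)
  then show ?case unfolding V_def .
qed

text \<open>A pointwise form of Chebyshev's inequality. With \<open>z\<close> the deficit of fresh
  moves below \<mu>, the shortfall of lone moves is at most max(0, z - c) \<le> z^2/(4c), and half
  of it is lost. The 1 in \<open>c\<close> allows for one lone move still owed.\<close>

lemma gap_ge:
  fixes \<mu> :: real
  assumes "real n + 1 < \<mu>"
  shows "gap_potential n w v t - 1 / 2 - (real (fresh_moves w v t) - \<mu>)\<^sup>2 / (8 * (\<mu> - real n - 1))
    \<le> real (front1 w v t) - real (front w v t)"
proof -
  define c where "c = \<mu> - real n - 1"
  define z where "z = \<mu> - real (fresh_moves w v t)"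
  define d where "d = z ^ 2 / (4 * c)"
  have c: "c > 0" using assms by (simp add: c_def)
  have "z - c \<le> z ^ 2 / (4 * c)"
  proof -
    have "0 \<le> (z - 2 * c) ^ 2" by simp
    then have "4 * c * (z - c) \<le> z ^ 2" by (simp add: power2_eq_square algebra_simps)
    then show ?thesis using c by (simp add: field_simps)
  qed
  moreover have "0 \<le> z ^ 2 / (4 * c)" using c by simp
  moreover have "real (n - lone_moves w v t) \<le> max 0 (z - c)"
  proof -
    have "fresh_moves w v t \<le> lone_moves w v t + 1"
      by (rule order_trans[OF fresh_moves_le_lone_moves]) simp
    then show ?thesis unfolding z_def c_def by linarith
  qed
  ultimately have "real (n - lone_moves w v t) \<le> z ^ 2 / (4 * c)" by linarith
  moreover have "gap_potential n w v t \<le>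
      real (front1 w v t - front w v t) + (real (n - lone_moves w v t) + 1) / 2"
    unfolding gap_potential_def using front_less_front1[of w v t]
    by (intro reflected_mean_le) simp
  moreover have "real (front1 w v t - front w v t) = real (front1 w v t) - real (front w v t)"
    using front_less_front1[of w v t] by (simp add: of_nat_diff less_imp_le)
  moreover have eq: "(real (fresh_moves w v t) - \<mu>)\<^sup>2 / (8 * (\<mu> - real n - 1)) = z ^ 2 / (4 * c) / 2"
    by (simp add: z_def c_def power2_commute)
  ultimately show ?thesis unfolding eq d_def[symmetric] by (simp add: field_simps)
qed

text \<open>The walk contributes 1/2 + sqrt(2\<mu>/5). Its 1/2 cancels the one lost in
  \<open>gap_ge\<close>, and the variance term costs at most the constant 100/152.\<close>

lemma average_gap_ge:
  fixes K :: "'a set"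
  assumes "finite K" "card K \<ge> 2" "L \<ge> 200 * card K"
  shows "real (card (word_pairs L K)) * sqrt (real L / (7 * real (card K)))
    \<le> (\<Sum>y\<in>word_pairs L K. real (front1 (y \<circ> Inl) (y \<circ> Inr) L) - real (front (y \<circ> Inl) (y \<circ> Inr) L))"
proof -
  let ?S = "word_pairs L K"
  define k where "k = real (card K)"
  define p where "p = (k - 1) / k ^ 2"
  define \<mu> where "\<mu> = p * real L"
  define n where "n = nat \<lfloor>4 / 5 * \<mu>\<rfloor>"
  have ne: "K \<noteq> {}" using assms(2) by auto
  have k: "k \<ge> 2" using assms(2) by (simp add: k_def)
  have Lk: "real L / k \<ge> 200"
  proof -
    have "real (200 * card K) \<le> real L" using assms(3) by (rule of_nat_mono)
    then show ?thesis using k by (simp add: k_def field_simps)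
  qed
  have mu_eq: "\<mu> = (1 - 1 / k) * (real L / k)"
    using k by (simp add: \<mu>_def p_def power2_eq_square field_simps)
  have half: "1 / 2 \<le> 1 - 1 / k" using k by (simp add: field_simps)
  have L_le: "real L / k \<le> 2 * \<mu>"
    using mult_right_mono[OF half, of "real L / k"] Lk unfolding mu_eq by simp
  have mu: "\<mu> \<ge> 100" using L_le Lk by simp
  have n_bounds: "real n \<le> 4 / 5 * \<mu>" "4 / 5 * \<mu> \<le> real n + 1" "n \<ge> 1"
    using mu unfolding n_def by linarith+
  define c where "c = \<mu> - real n - 1"
  \<comment> \<open>Here 19/100 is 1/5 - 1/100, the subtracted 1 being at most \<mu>/100.\<close>
  have c: "c \<ge> 19 / 100 * \<mu>" "c > 0" using n_bounds mu unfolding c_def by linarith+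
  have "\<mu> / (8 * c) \<le> 100 / 152" using c by (simp add: field_simps)
  moreover have "1 / 2 + sqrt (2 / 5 * \<mu>) \<le> reflected_mean n 1"
  proof -
    have "sqrt (2 / 5 * \<mu>) \<le> sqrt ((real n + 1) / 2)"
      using n_bounds by (intro real_sqrt_le_mono) simp
    then show ?thesis using reflected_mean_one_ge[OF n_bounds(3)] by linarith
  qed
  moreover have "sqrt (real L / (7 * k)) + 100 / 152 \<le> sqrt (2 / 5 * \<mu>)"
  proof -
    define s where "s = sqrt \<mu>"
    have s: "s \<ge> 10" using mu unfolding s_def by (intro real_le_rsqrt) simp
    have "sqrt (real L / (7 * k)) \<le> sqrt (2 / 7 * \<mu>)"
      using L_le by (intro real_sqrt_le_mono) (simp add: field_simps)
    also have "\<dots> = sqrt (2 / 7) * s" unfolding s_def by (rule real_sqrt_mult)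
    \<comment> \<open>Rounding sqrt(2/7) up to 0.54 and sqrt(2/5) down to 0.63 leaves a margin 0.09
      s \<ge> 0.9, which absorbs 100/152.\<close>
    also have "\<dots> \<le> 54 / 100 * s"
      using s by (intro mult_right_mono real_le_lsqrt) (auto simp: power2_eq_square)
    also have "\<dots> + 100 / 152 \<le> 63 / 100 * s" using s by simp
    also have "\<dots> \<le> sqrt (2 / 5) * s"
      using s by (intro mult_right_mono real_le_rsqrt) (auto simp: power2_eq_square)
    also have "\<dots> = sqrt (2 / 5 * \<mu>)" unfolding s_def by (rule real_sqrt_mult[symmetric])
    finally show ?thesis by simp
  qed
  ultimately have "sqrt (real L / (7 * k)) \<le> reflected_mean n 1 - 1 / 2 - \<mu> / (8 * c)"
    by linarith
  then have "real (card ?S) * sqrt (real L / (7 * k))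
    \<le> real (card ?S) * (reflected_mean n 1 - 1 / 2 - \<mu> / (8 * c))"
    by (rule mult_left_mono) simp
  also have "\<dots> = real (card ?S) * reflected_mean n 1 - real (card ?S) * (1 / 2)
      - real (card ?S) * (p * real L) / (8 * c)"
    by (simp add: \<mu>_def algebra_simps)
  also have "\<dots> \<le> (\<Sum>y\<in>?S. gap_potential n (y \<circ> Inl) (y \<circ> Inr) L) - real (card ?S) * (1 / 2)
      - (\<Sum>y\<in>?S. (real (fresh_moves (y \<circ> Inl) (y \<circ> Inr) L) - \<mu>)\<^sup>2) / (8 * c)"
    using sum_gap_potential_ge[OF assms(1) ne order.refl, of L n]
      sum_fresh_moves_variance_le[OF assms(1) ne order.refl, of L] c
    unfolding k_def[symmetric] p_def[symmetric] \<mu>_def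
    by (intro diff_mono divide_right_mono) auto
  also have "\<dots> = (\<Sum>y\<in>?S. gap_potential n (y \<circ> Inl) (y \<circ> Inr) L - 1 / 2
      - (real (fresh_moves (y \<circ> Inl) (y \<circ> Inr) L) - \<mu>)\<^sup>2 / (8 * c))"
    by (simp add: sum_subtractf sum_divide_distrib)
  also have "\<dots> \<le> (\<Sum>y\<in>?S. real (front1 (y \<circ> Inl) (y \<circ> Inr) L) - real (front (y \<circ> Inl) (y \<circ> Inr) L))"
    unfolding c_def using c by (intro sum_mono gap_ge) (simp add: c_def)
  finally show ?thesis by (simp add: k_def)
qed

section \<open>From the finite average to the expectation\<close>

theorem theorem3:
  fixes M :: "'a measure"
    and w w' :: "nat \<Rightarrow> 'a \<Rightarrow> nat"
    and k L :: nat
  assumes "prob_space M"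
    and "k \<ge> 2"
    and "L \<ge> 200 * k"
    and "prob_space.indep_vars M (\<lambda>_. count_space UNIV)
           (\<lambda>s. case s of Inl i \<Rightarrow> w i | Inr i \<Rightarrow> w' i) (UNIV :: (nat + nat) set)"
    and "\<And>i. distr M (count_space UNIV) (w i) = measure_pmf (pmf_of_set {1..k})"
    and "\<And>i. distr M (count_space UNIV) (w' i) = measure_pmf (pmf_of_set {1..k})"
  shows "prob_space.expectation M
           (\<lambda>\<omega>. real (max_prefix (\<lambda>i. w i \<omega>) (\<lambda>i. w' i \<omega>) 1 L)
               - real (max_prefix (\<lambda>i. w i \<omega>) (\<lambda>i. w' i \<omega>) 0 L))
         \<ge> sqrt (real L / (7 * real k))"
proof -
  interpret prob_space M by fact
  let ?S = "word_pairs L {1..k}"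
  define X where "X = (\<lambda>s. case s of Inl i \<Rightarrow> w i | Inr i \<Rightarrow> w' i)"
  define F where "F x = real (max_prefix (x \<circ> Inl) (x \<circ> Inr) 1 L)
    - real (max_prefix (x \<circ> Inl) (x \<circ> Inr) 0 L)" for x :: "nat + nat \<Rightarrow> nat"
  \<comment> \<open>Only the first \<open>L + 1\<close> symbols of \<open>w\<close> and the first
    \<open>L\<close> of \<open>w'\<close> matter, and \<open>word_coords L\<close> contains all of
    these.\<close>
  have F: "F (restrict x (word_coords L)) = F x" for x
    unfolding F_def
    by (intro arg_cong2[where f = "(-)"] arg_cong[where f = real] max_prefix_cong) auto
  have card: "card ?S = k ^ card (word_coords L)"
    by (simp add: card_PiE)
  have pos: "card ?S > 0" using assms(2) unfolding card by simp
  have "expectation (\<lambda>\<omega>. F (\<lambda>s. X s \<omega>)) =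
    (\<Sum>y\<in>?S. F y) / real (card {1..k}) ^ card (word_coords L)"
    using assms(2,4-6) F
    by (intro expectation_uniform_coords) (auto simp: X_def split: sum.split)
  then have E: "expectation (\<lambda>\<omega>. F (\<lambda>s. X s \<omega>)) = (\<Sum>y\<in>?S. F y) / real (card ?S)"
    unfolding card by simp
  have "real (card ?S) * sqrt (real L / (7 * real k))
    \<le> (\<Sum>y\<in>?S. real (front1 (y \<circ> Inl) (y \<circ> Inr) L) - real (front (y \<circ> Inl) (y \<circ> Inr) L))"
    using average_gap_ge[of "{1..k}" L] assms(2,3) by simp
  also have "\<dots> \<le> (\<Sum>y\<in>?S. F y)"
    unfolding F_def by (intro sum_mono front1_minus_front_le)
  finally have "sqrt (real L / (7 * real k)) \<le> (\<Sum>y\<in>?S. F y) / real (card ?S)"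
    using pos by (simp add: field_simps)
  then show ?thesis
    unfolding E[symmetric] by (simp add: F_def X_def comp_def)
qed

end
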